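(* For all integers $d\geq 1$, all $\sigma>0$, and all $0<\varepsilon\leq 1$ we have $$\mathcal{H}\bigl(\mathrm{Id}: H_\sigma(B_2^d)\to\ell_\infty(B_2^d),\,\varepsilon\bigr) \leq \binom{2e(1+\sigma^2)+d}{d}\cdot e^{-d}\cdot \frac{\bigl(\log(4/\varepsilon)\bigr)^{d+1}}{\bigl(\log\log(4/\varepsilon)\bigr)^{d}}.$$
   Context: $B_2^d\subseteq\mathbb{R}^d$ denotes the closed Euclidean unit ball. For $\sigma>0$ and $X\subseteq\mathbb{R}^d$, $H_\sigma(X)$ is the reproducing kernel Hilbert space (of real-valued functions on $X$) of the isotropic Gaussian kernel $k_\sigma(x,x')=\exp(-\sigma^2\|x-x'\|_{\ell_2^d}^2)$, $x,x'\in X$, where $\|\cdot\|_{\ell_2^d}$ is the Euclidean norm. $\ell_\infty(X)$ is the Banach space of bounded functions $f:X\to\mathbb{R}$ with the supremum norm, and $\mathrm{Id}$ is the canonical embedding $f\mapsto f$. For a bounded subset $A$ of a Banach space $E$ with closed unit ball $B_E$, the covering numbers are $\mathcal{N}(A,\varepsilon)=\min\{n\in\{1,2,\ldots\}: \exists x_1,\ldots,x_n\in E \text{ with } A\subseteq\bigcup_{i=1}^n (x_i+\varepsilon B_E)\}$, $\varepsilon>0$. For a bounded linear operator $T:E\to F$ between Banach spaces, the log-covering numbers are $\mathcal{H}(T,\varepsilon)=\log\mathcal{N}(T B_E,\varepsilon)$, with $\log$ the natural logarithm. For real $t>0$ and integer $d\geq1$ the generalized binomial coefficient is $\binom{t+d}{d}=\frac{1}{d!}\prod_{i=1}^d(t+i)$.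 *)

theory Defs
  imports "HOL-Analysis.Analysis"
begin

text \<open>
  Real-valued functions on a set \<open>X\<close> are encoded as elements of \<^term>\<open>extensional X\<close>, so that two
  functions on \<open>X\<close> are equal iff they agree on \<open>X\<close>. The pointwise vector space operations therefore
  have to be restricted to \<open>X\<close>.
\<close>

definition fun_zero :: "'a set \<Rightarrow> 'a \<Rightarrow> real" where
  "fun_zero X = (\<lambda>x\<in>X. 0)"

definition fun_add :: "'a set \<Rightarrow> ('a \<Rightarrow> real) \<Rightarrow> ('a \<Rightarrow> real) \<Rightarrow> 'a \<Rightarrow> real" where
  "fun_add X f g = (\<lambda>x\<in>X. f x + g x)"

definition fun_scale :: "'a set \<Rightarrow> real \<Rightarrow> ('a \<Rightarrow> real) \<Rightarrow> 'a \<Rightarrow> real" where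
  "fun_scale X c f = (\<lambda>x\<in>X. c * f x)"

definition fun_diff :: "'a set \<Rightarrow> ('a \<Rightarrow> real) \<Rightarrow> ('a \<Rightarrow> real) \<Rightarrow> 'a \<Rightarrow> real" where
  "fun_diff X f g = (\<lambda>x\<in>X. f x - g x)"

definition ip_norm :: "(('a \<Rightarrow> real) \<Rightarrow> ('a \<Rightarrow> real) \<Rightarrow> real) \<Rightarrow> ('a \<Rightarrow> real) \<Rightarrow> real" where
  "ip_norm ip f = sqrt (ip f f)"

locale function_hilbert_space =
  fixes X :: "'a set"
    and H :: "('a \<Rightarrow> real) set"
    and ip :: "('a \<Rightarrow> real) \<Rightarrow> ('a \<Rightarrow> real) \<Rightarrow> real"
  assumes carrier: "H \<subseteq> extensional X"
    and zero_closed: "fun_zero X \<in> H"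
    and add_closed: "f \<in> H \<Longrightarrow> g \<in> H \<Longrightarrow> fun_add X f g \<in> H"
    and scale_closed: "f \<in> H \<Longrightarrow> fun_scale X c f \<in> H"
    and ip_sym: "f \<in> H \<Longrightarrow> g \<in> H \<Longrightarrow> ip f g = ip g f"
    and ip_add: "f \<in> H \<Longrightarrow> g \<in> H \<Longrightarrow> h \<in> H \<Longrightarrow> ip (fun_add X f g) h = ip f h + ip g h"
    and ip_scale: "f \<in> H \<Longrightarrow> g \<in> H \<Longrightarrow> ip (fun_scale X c f) g = c * ip f g"
    and ip_nonneg: "f \<in> H \<Longrightarrow> 0 \<le> ip f f"
    and ip_definite: "f \<in> H \<Longrightarrow> ip f f = 0 \<Longrightarrow> f = fun_zero X"
    and complete: "(\<And>n. s n \<in> H) \<Longrightarrow>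
        (\<And>e. 0 < e \<Longrightarrow> \<exists>N. \<forall>m\<ge>N. \<forall>n\<ge>N. ip_norm ip (fun_diff X (s m) (s n)) < e) \<Longrightarrow>
        \<exists>f\<in>H. (\<lambda>n::nat. ip_norm ip (fun_diff X (s n) f)) \<longlonglongrightarrow> 0"

text \<open>
  The reproducing kernel Hilbert space of a positive definite kernel \<open>k\<close> on \<open>X\<close> exists and is unique
  (Moore--Aronszajn); the following predicate characterises it, together with its inner product.
\<close>

locale rkhs = function_hilbert_space X H ip
  for X :: "'a set" and k :: "'a \<Rightarrow> 'a \<Rightarrow> real"
    and H :: "('a \<Rightarrow> real) set" and ip :: "('a \<Rightarrow> real) \<Rightarrow> ('a \<Rightarrow> real) \<Rightarrow> real" +
  assumes kernel_section: "x \<in> X \<Longrightarrow> (\<lambda>y\<in>X. k y x) \<in> H"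
    and reproducing: "f \<in> H \<Longrightarrow> x \<in> X \<Longrightarrow> f x = ip f (\<lambda>y\<in>X. k y x)"

definition hilbert_unit_ball ::
    "('a \<Rightarrow> real) set \<Rightarrow> (('a \<Rightarrow> real) \<Rightarrow> ('a \<Rightarrow> real) \<Rightarrow> real) \<Rightarrow> ('a \<Rightarrow> real) set" where
  "hilbert_unit_ball H ip = {f \<in> H. ip_norm ip f \<le> 1}"

definition gaussian_kernel :: "real \<Rightarrow> real ^ 'd \<Rightarrow> real ^ 'd \<Rightarrow> real" where
  "gaussian_kernel \<sigma> x y = exp (- (\<sigma>\<^sup>2 * (norm (x - y))\<^sup>2))"

text \<open>
  The space of bounded functions on \<open>X\<close> is the library's \<^const>\<open>funspace\<close>, carrying the metric induced
  by the supremum norm.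
\<close>

definition linfty :: "'a set \<Rightarrow> ('a \<Rightarrow> real) metric" where
  "linfty X = funspace X euclidean_metric"

lemma mspace_linfty: "mspace (linfty X) = {f \<in> extensional X. bounded (f ` X)}"
proof -
  have "Metric_space.mbounded UNIV dist S \<longleftrightarrow> bounded S" for S :: "real set"
    by (auto simp: Metric_space.mbounded_def Met_TC.mcball_def bounded_def)
  then show ?thesis
    by (auto simp: linfty_def Met_TC.fspace_def)
qed

lemma mdist_linfty:
  assumes "f \<in> mspace (linfty X)" "g \<in> mspace (linfty X)" "X \<noteq> {}"
  shows "mdist (linfty X) f g = (SUP x\<in>X. \<bar>f x - g x\<bar>)"
  using assms by (simp add: linfty_def Met_TC.fdist_def dist_real_def)

text \<open>
  In a Banach space the sets \<open>x + \<epsilon> B\<close> are the closed metric balls. The value is \<open>\<infinity>\<close> if no finite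
  cover exists; an infimum over \<^typ>\<open>nat\<close> would wrongly yield \<open>0\<close> in that case.
\<close>

definition covering_number :: "'b metric \<Rightarrow> 'b set \<Rightarrow> real \<Rightarrow> enat" where
  "covering_number m A \<epsilon> =
     Inf {enat n | n. n \<ge> 1 \<and>
       (\<exists>x :: nat \<Rightarrow> 'b. (\<forall>i\<in>{1..n}. x i \<in> mspace m) \<and> A \<subseteq> (\<Union>i\<in>{1..n}. mcball_of m (x i) \<epsilon>))}"

definition log_covering_number :: "('a \<Rightarrow> 'b) \<Rightarrow> 'a set \<Rightarrow> 'b metric \<Rightarrow> real \<Rightarrow> ereal" where
  "log_covering_number T B m \<epsilon> =
     (case covering_number m (T ` B) \<epsilon> of enat n \<Rightarrow> ereal (ln (real n)) | \<infinity> \<Rightarrow> \<infinity>)"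

text \<open>The generalized binomial coefficient is the library's \<open>gchoose\<close>.\<close>

lemma gchoose_shift_eq:
  fixes t :: real
  shows "(t + real d) gchoose d = (\<Prod>i=1..d. t + real i) / fact d"
proof -
  have "pochhammer (t + 1) d = (\<Prod>i=1..d. t + real i)"
    by (simp add: pochhammer_prod prod.atLeast1_atMost_eq atLeast0LessThan add_ac)
  then show ?thesis
    by (simp add: gbinomial_pochhammer')
qed

end

theory Submission
  imports Defs
begin

text \<open>
  Write $\lambda = 2\sigma^2$ and $L = \log(4/\varepsilon)$. Expanding $e^{\lambda\langle x, y\rangle}$
  into monomials writes the Gaussian kernel as $k(x,y) = \sum_\alpha \varphi_\alpha(x) \varphi_\alpha(y)$
  over all multi-indices (\<open>gaussian_kernel_has_sum\<close>). Functions in the unit ball of the Hilbert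
  space are then series $\sum_\alpha w_\alpha \varphi_\alpha$ with $\sum_\alpha w_\alpha^2 \le 1$, and
  truncation at total degree \<open>n\<close> causes a uniform error of at most
  $\sup_x (\sum_{|\alpha| > n} \varphi_\alpha(x)^2)^{1/2}$.

  The sum under the root is at most a Poisson tail, which Chernoff's method with parameter
  $\theta \ge 1$ bounds by $e^{\lambda(\theta - 1)} \theta^{-(n+1)}$ (\<open>gauss_feature_tail\<close>). The choice
  $\theta = L$ and $n = \lfloor (\lambda + 2) L / \log L \rfloor$ makes it at most
  $e^{-2L} = (\varepsilon/4)^2$.

  The truncated functions form an image of a Euclidean ball of dimension
  $D = \binom{n+d}{d}$ under a map that does not increase distances into the sup norm. A volume
  argument gives a $\frac{3}{4}\varepsilon$-net of at most $(1 + \frac{8}{3\varepsilon})^D \le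
  (4/\varepsilon)^D$ elements (\<open>L2_ball_net\<close>), so the log-covering number is at most $D L$. Finally
  $n \le 2e(1+\sigma^2) \cdot x$ with $x = L / (e \log L) \ge 1$, so that
  $D \le \binom{2e(1+\sigma^2)+d}{d} x^d$ (\<open>binomial_le_gchoose\<close>).

  The series representation is established only on finite sets of points
  (\<open>unit_ball_approx_on_finite\<close>), where it follows from projecting onto finitely many
  kernel sections. As the net is finite, this is enough: one point per element of the net witnesses
  its failure to approximate a given function.
\<close>

section \<open>Nets in Euclidean balls\<close>

text \<open>
  The volume comparison below lives in $\mathbb{R}^A$ for a finite set \<open>A\<close> that is not a type, so
  Lebesgue measure is taken as the product measure \<open>Pi\<^sub>M A (\<lambda>_. lborel)\<close>. The volume of its
  balls around the origin is \<open>emeasure_cball_aux\<close>; translation invariance, which holds because it holds on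
  boxes, gives the other balls.
\<close>

lemma distr_PiM_lborel_translate:
  fixes c :: "'i \<Rightarrow> real"
  assumes "finite A"
  shows "distr (Pi\<^sub>M A (\<lambda>_. lborel)) (Pi\<^sub>M A (\<lambda>_. lborel)) (\<lambda>f. \<lambda>i\<in>A. f i + c i)
    = Pi\<^sub>M A (\<lambda>_. lborel)"
proof -
  interpret product_sigma_finite "\<lambda>_::'i. lborel :: real measure"
    by unfold_locales
  show ?thesis
  proof (rule PiM_eqI)
    fix B :: "'i \<Rightarrow> real set"
    assume B: "\<And>i. i \<in> A \<Longrightarrow> B i \<in> sets lborel"
    have shift: "emeasure lborel ((\<lambda>x. x + c i) -` B i) = emeasure lborel (B i)" if "i \<in> A" for i
    proof -
      have plus: "(+) (c i) = (\<lambda>x. x + c i)" by (simp add: fun_eq_iff add.commute)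
      have "emeasure (distr lborel borel ((+) (c i))) (B i) = emeasure lborel ((\<lambda>x. x + c i) -` B i)"
        using B[OF that] by (subst emeasure_distr) (auto simp: plus)
      then show ?thesis by (simp add: lborel_distr_plus)
    qed
    have pre: "(\<lambda>f. \<lambda>i\<in>A. f i + c i) -` Pi\<^sub>E A B \<inter> space (Pi\<^sub>M A (\<lambda>_. lborel))
        = Pi\<^sub>E A (\<lambda>i. (\<lambda>x. x + c i) -` B i)"
      by (auto simp: space_PiM PiE_iff)
    have meas: "(\<lambda>x. x + c i) -` B i \<in> sets lborel" if "i \<in> A" for i
      using B[OF that] measurable_sets[of "\<lambda>x. x + c i" borel borel "B i"] by simp
    have "emeasure (distr (Pi\<^sub>M A (\<lambda>_. lborel)) (Pi\<^sub>M A (\<lambda>_. lborel)) (\<lambda>f. \<lambda>i\<in>A. f i + c i)) (Pi\<^sub>E A B)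
       = emeasure (Pi\<^sub>M A (\<lambda>_. lborel)) (Pi\<^sub>E A (\<lambda>i. (\<lambda>x. x + c i) -` B i))"
      using B assms by (subst emeasure_distr) (auto simp: pre intro!: sets_PiM_I_finite)
    also have "\<dots> = (\<Prod>i\<in>A. emeasure lborel ((\<lambda>x. x + c i) -` B i))"
      using assms meas by (rule emeasure_PiM)
    also have "\<dots> = (\<Prod>i\<in>A. emeasure lborel (B i))"
      using shift by (intro prod.cong) auto
    finally show "emeasure (distr (Pi\<^sub>M A (\<lambda>_. lborel)) (Pi\<^sub>M A (\<lambda>_. lborel))
        (\<lambda>f. \<lambda>i\<in>A. f i + c i)) (Pi\<^sub>E A B) = (\<Prod>i\<in>A. emeasure lborel (B i))" .
  qed (use assms in auto)
qed

lemma sets_PiM_L2_ball: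
  fixes c :: "'i \<Rightarrow> real"
  assumes "finite A"
  shows "{f \<in> space (Pi\<^sub>M A (\<lambda>_. lborel)). L2_set (\<lambda>i. f i - c i) A \<le> r}
    \<in> sets (Pi\<^sub>M A (\<lambda>_. lborel))"
proof -
  have [measurable]: "(\<lambda>f. f i) \<in> borel_measurable (Pi\<^sub>M A (\<lambda>_. lborel :: real measure))" if "i \<in> A" for i
    using measurable_component_singleton[OF that, of "\<lambda>_. lborel :: real measure"] by simp
  have "(\<lambda>f. L2_set (\<lambda>i. f i - c i) A) \<in> borel_measurable (Pi\<^sub>M A (\<lambda>_. lborel :: real measure))"
    unfolding L2_set_def by measurable
  then show ?thesis by measurable
qed

lemma emeasure_L2_ball:
  fixes c :: "'i \<Rightarrow> real"
  assumes "finite A" "r > 0"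
  shows "emeasure (Pi\<^sub>M A (\<lambda>_. lborel))
      {f \<in> space (Pi\<^sub>M A (\<lambda>_. lborel)). L2_set (\<lambda>i. f i - c i) A \<le> r}
    = ennreal (unit_ball_vol (real (card A)) * r ^ card A)"
proof -
  let ?M = "Pi\<^sub>M A (\<lambda>_. lborel :: real measure)"
  let ?T = "\<lambda>f. \<lambda>i\<in>A. f i + c i"
  let ?B = "{f \<in> space ?M. L2_set (\<lambda>i. f i - c i) A \<le> r}"
  have T: "?T \<in> measurable ?M ?M"
  proof (rule measurable_restrict)
    fix i assume i: "i \<in> A"
    have "(\<lambda>f. f i) \<in> borel_measurable ?M"
      using measurable_component_singleton[OF i, of "\<lambda>_. lborel :: real measure"] by simp
    then show "(\<lambda>f. f i + c i) \<in> measurable ?M lborel" by simp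
  qed
  have L2: "L2_set (\<lambda>i. (if i \<in> A then f i + c i else undefined) - c i) A = L2_set f A" for f
    by (intro L2_set_cong) auto
  have "emeasure ?M ?B = emeasure (distr ?M ?M ?T) ?B"
    by (simp add: distr_PiM_lborel_translate assms)
  also have "\<dots> = emeasure ?M (?T -` ?B \<inter> space ?M)"
    using T sets_PiM_L2_ball[OF assms(1)] by (rule emeasure_distr)
  also have "?T -` ?B \<inter> space ?M = {f. sqrt (\<Sum>i\<in>A. (f i)\<^sup>2) \<le> r} \<inter> space ?M"
    by (auto simp: space_PiM restrict_def L2 L2_set_def[symmetric])
  finally show ?thesis using emeasure_cball_aux[OF assms] by simp
qed

text \<open>
  Volume comparison: balls of radius \<open>\<delta> / 2\<close> around the points of a \<open>\<delta>\<close>-separated subset of the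
  unit ball are disjoint and lie in the ball of radius \<open>1 + \<delta> / 2\<close>, and the quotient of the volumes
  is \<open>(1 + 2 / \<delta>) ^ card A\<close>.
\<close>

lemma card_separated_le:
  fixes C :: "('i \<Rightarrow> real) set"
  assumes A: "finite A" and C: "finite C" "C \<subseteq> A \<rightarrow>\<^sub>E UNIV" and \<delta>: "\<delta> > 0"
    and ball: "\<And>c. c \<in> C \<Longrightarrow> L2_set c A \<le> 1"
    and sep: "\<And>c c'. c \<in> C \<Longrightarrow> c' \<in> C \<Longrightarrow> c \<noteq> c' \<Longrightarrow> L2_set (\<lambda>i. c i - c' i) A > \<delta>"
  shows "real (card C) \<le> (1 + 2 / \<delta>) ^ card A"
proof -
  let ?M = "Pi\<^sub>M A (\<lambda>_. lborel :: real measure)"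
  let ?B = "\<lambda>c r. {f \<in> space ?M. L2_set (\<lambda>i. f i - c i) A \<le> r}"
  let ?v = "unit_ball_vol (real (card A))"
  have v: "?v > 0" by simp
  have disj: "disjoint_family_on (\<lambda>c. ?B c (\<delta> / 2)) C"
  proof (unfold disjoint_family_on_def, intro ballI impI)
    fix c c' assume cc: "c \<in> C" "c' \<in> C" "c \<noteq> c'"
    have False if f: "L2_set (\<lambda>i. f i - c i) A \<le> \<delta> / 2" "L2_set (\<lambda>i. f i - c' i) A \<le> \<delta> / 2" for f
    proof -
      have "L2_set (\<lambda>i. c i - c' i) A = L2_set (\<lambda>i. (c i - f i) + (f i - c' i)) A" by simp
      also have "\<dots> \<le> L2_set (\<lambda>i. c i - f i) A + L2_set (\<lambda>i. f i - c' i) A"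
        by (rule L2_set_triangle_ineq)
      also have "L2_set (\<lambda>i. c i - f i) A = L2_set (\<lambda>i. f i - c i) A"
        by (simp add: L2_set_def power2_commute)
      finally show False using f sep[OF cc] by simp
    qed
    then show "?B c (\<delta> / 2) \<inter> ?B c' (\<delta> / 2) = {}" by blast
  qed
  have sub: "(\<Union>c\<in>C. ?B c (\<delta> / 2)) \<subseteq> ?B (\<lambda>_. 0) (1 + \<delta> / 2)"
  proof
    fix f assume "f \<in> (\<Union>c\<in>C. ?B c (\<delta> / 2))"
    then obtain c where c: "c \<in> C" and f: "f \<in> space ?M" "L2_set (\<lambda>i. f i - c i) A \<le> \<delta> / 2"
      by blast
    have "L2_set f A = L2_set (\<lambda>i. c i + (f i - c i)) A" by simp
    also have "\<dots> \<le> L2_set c A + L2_set (\<lambda>i. f i - c i) A" by (rule L2_set_triangle_ineq)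
    finally show "f \<in> ?B (\<lambda>_. 0) (1 + \<delta> / 2)" using ball[OF c] f by simp
  qed
  have "ennreal (real (card C) * (?v * (\<delta> / 2) ^ card A))
      = (\<Sum>c\<in>C. ennreal (?v * (\<delta> / 2) ^ card A))"
    using v \<delta> by (simp add: ennreal_mult' ennreal_of_nat_eq_real_of_nat)
  also have "\<dots> = (\<Sum>c\<in>C. emeasure ?M (?B c (\<delta> / 2)))"
    using emeasure_L2_ball[OF A, of "\<delta> / 2"] \<delta> by simp
  also have "\<dots> = emeasure ?M (\<Union>c\<in>C. ?B c (\<delta> / 2))"
    using C(1) disj sets_PiM_L2_ball[OF A] by (intro sum_emeasure) (blast, assumption+)
  also have "\<dots> \<le> emeasure ?M (?B (\<lambda>_. 0) (1 + \<delta> / 2))"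
    using sub sets_PiM_L2_ball[OF A] by (rule emeasure_mono)
  also have "\<dots> = ennreal (?v * (1 + \<delta> / 2) ^ card A)"
    using \<delta> by (intro emeasure_L2_ball A) auto
  finally have "real (card C) * (?v * (\<delta> / 2) ^ card A) \<le> ?v * (1 + \<delta> / 2) ^ card A"
    using v \<delta> by (subst (asm) ennreal_le_iff) auto
  then have "real (card C) * (\<delta> / 2) ^ card A \<le> (1 + \<delta> / 2) ^ card A"
    using v by (simp add: mult.left_commute)
  then have "real (card C) \<le> (1 + \<delta> / 2) ^ card A / (\<delta> / 2) ^ card A"
    using \<delta> by (simp add: le_divide_eq)
  also have "\<dots> = ((1 + \<delta> / 2) / (\<delta> / 2)) ^ card A"
    by (rule power_divide[symmetric])
  also have "(1 + \<delta> / 2) / (\<delta> / 2) = 1 + 2 / \<delta>"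
    using \<delta> by (simp add: field_simps)
  finally show ?thesis .
qed

text \<open>
  A separated subset of the unit ball of maximal cardinality is a \<open>\<delta>\<close>-net, since a point that is far
  from all its elements could be added to it.
\<close>

lemma L2_ball_net:
  fixes A :: "'i set" and \<delta> :: real
  assumes A: "finite A" and \<delta>: "\<delta> > 0"
  obtains C :: "('i \<Rightarrow> real) set" where "finite C" "real (card C) \<le> (1 + 2 / \<delta>) ^ card A"
    "\<And>w. L2_set w A \<le> 1 \<Longrightarrow> \<exists>c\<in>C. L2_set (\<lambda>i. w i - c i) A \<le> \<delta>"
proof -
  define P where "P C \<longleftrightarrow> finite C \<and> C \<subseteq> A \<rightarrow>\<^sub>E UNIV \<and> (\<forall>c\<in>C. L2_set c A \<le> 1) \<and>
    (\<forall>c\<in>C. \<forall>c'\<in>C. c \<noteq> c' \<longrightarrow> L2_set (\<lambda>i. c i - c' i) A > \<delta>)" for C :: "('i \<Rightarrow> real) set"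
  have bound: "real (card C) \<le> (1 + 2 / \<delta>) ^ card A" if "P C" for C
    using that \<delta> A by (intro card_separated_le) (auto simp: P_def)
  have "P {}" by (simp add: P_def)
  moreover have "\<forall>C. P C \<longrightarrow> card C < Suc (nat \<lfloor>(1 + 2 / \<delta>) ^ card A\<rfloor>)"
    using bound by (auto simp: less_Suc_eq_le le_nat_floor)
  ultimately obtain C where C: "P C" and max: "\<And>C'. P C' \<Longrightarrow> card C' \<le> card C"
    using ex_has_greatest_nat[of P "{}" card] by blast
  have "\<exists>c\<in>C. L2_set (\<lambda>i. w i - c i) A \<le> \<delta>" if w: "L2_set w A \<le> 1" for w
  proof (rule ccontr)
    assume "\<not> ?thesis"
    then have far: "L2_set (\<lambda>i. w i - c i) A > \<delta>" if "c \<in> C" for c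
      using that by force
    \<comment> \<open>Nets consist of extensional functions, so that distinct elements differ on \<open>A\<close>;
      a general \<open>w\<close> has to be cut down to \<open>A\<close> first.\<close>
    define w' where "w' = restrict w A"
    have far': "L2_set (\<lambda>i. w' i - c i) A > \<delta>" "L2_set (\<lambda>i. c i - w' i) A > \<delta>" if "c \<in> C" for c
      using far[OF that] by (simp_all add: L2_set_def w'_def power2_commute)
    have "w' \<notin> C" using far'(1)[of w'] \<delta> by (auto simp: L2_set_def)
    moreover have "P (insert w' C)"
      using C w far' by (auto simp: P_def w'_def L2_set_def)
    ultimately show False using max[of "insert w' C"] C by (simp add: P_def)
  qed
  with bound[OF C] C show ?thesis by (intro that[of C]) (auto simp: P_def)
qed

section \<open>Multi-indices\<close>

definition multi_deg :: "('d::finite \<Rightarrow> nat) \<Rightarrow> nat" where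
  "multi_deg \<alpha> = (\<Sum>j\<in>UNIV. \<alpha> j)"

text \<open>
  Listing the entries of a multi-index followed by the slack \<open>n - multi_deg \<alpha>\<close> turns the
  multi-indices of degree at most \<open>n\<close> into weak compositions of \<open>n\<close> with one more part, which
  \<open>card_length_sum_list\<close> counts.
\<close>

lemma multi_deg_le:
  fixes n :: nat
  shows finite_multi_deg_le: "finite {\<alpha> :: 'd::finite \<Rightarrow> nat. multi_deg \<alpha> \<le> n}"
    and card_multi_deg_le: "card {\<alpha> :: 'd \<Rightarrow> nat. multi_deg \<alpha> \<le> n} \<le> (n + CARD('d)) choose CARD('d)"
proof -
  let ?S = "{\<alpha> :: 'd \<Rightarrow> nat. multi_deg \<alpha> \<le> n}"
  let ?T = "{l :: nat list. length l = Suc CARD('d) \<and> sum_list l = n}"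
  obtain xs :: "'d list" where xs: "set xs = UNIV" "distinct xs"
    using finite_distinct_list[of "UNIV :: 'd set"] by auto
  then have len: "length xs = CARD('d)" by (metis distinct_card)
  define code where "code \<alpha> = map \<alpha> xs @ [n - multi_deg \<alpha>]" for \<alpha> :: "'d \<Rightarrow> nat"
  have "inj_on code ?S"
    using xs by (auto simp: inj_on_def code_def fun_eq_iff)
  moreover have "code ` ?S \<subseteq> ?T"
    using xs len by (auto simp: code_def multi_deg_def sum_list_distinct_conv_sum_set)
  moreover have T: "card ?T = (n + CARD('d)) choose CARD('d)"
    using binomial_symmetric[of n "n + CARD('d)"] by (simp add: card_length_sum_list)
  moreover have "finite ?T"
    using T by (intro card_ge_0_finite) simp
  ultimately show "finite ?S" "card ?S \<le> (n + CARD('d)) choose CARD('d)"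
    using card_inj_on_le[of code ?S ?T] finite_imageD[of code ?S] finite_subset[of "code ` ?S" ?T]
    by auto
qed

text \<open>
  The product of the exponential series in the single coordinates, multiplied out. This replaces the
  multinomial theorem: expanding $e^{\langle x, y\rangle}$ coordinatewise gives the monomials
  directly.
\<close>

lemma exp_has_sum_multiindex:
  fixes u :: "'d::finite \<Rightarrow> real"
  shows "((\<lambda>\<alpha>. \<Prod>j\<in>UNIV. u j ^ \<alpha> j / fact (\<alpha> j)) has_sum exp (\<Sum>j\<in>UNIV. u j)) UNIV"
proof -
  have exp_series: "((\<lambda>n. x ^ n / fact n) has_sum exp x) UNIV"
    and exp_abs: "(\<lambda>n. norm (x ^ n / fact n)) summable_on UNIV" for x :: real
  proof -
    have s: "summable (\<lambda>n. norm (x ^ n / fact n))"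
      using summable_norm_exp[of x] by (simp add: divide_inverse mult.commute)
    have "(\<lambda>n. x ^ n / fact n) sums exp x"
      using exp_converges[of x] by (simp add: divide_inverse mult.commute)
    with s show "((\<lambda>n. x ^ n / fact n) has_sum exp x) UNIV"
      by (rule norm_summable_imp_has_sum)
    show "(\<lambda>n. norm (x ^ n / fact n)) summable_on UNIV"
      using s by (intro norm_summable_imp_summable_on) simp
  qed
  let ?p = "\<lambda>u \<alpha>. \<Prod>j\<in>UNIV. (u j :: real) ^ \<alpha> j / fact (\<alpha> j)"
  \<comment> \<open>A finite set of multi-indices lies in a cube, on which the sum factorises.\<close>
  have bound: "sum (?p (\<lambda>j. \<bar>u j\<bar>)) F \<le> (\<Prod>j\<in>UNIV. exp \<bar>u j\<bar>)" if F: "finite F" for F :: "('d \<Rightarrow> nat) set"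
  proof -
    define K where "K = Max (insert 0 (\<Union>\<alpha>\<in>F. range \<alpha>))"
    have "F \<subseteq> UNIV \<rightarrow>\<^sub>E {..K}"
      using F by (auto simp: K_def intro!: Max_ge)
    then have "sum (?p (\<lambda>j. \<bar>u j\<bar>)) F \<le> sum (?p (\<lambda>j. \<bar>u j\<bar>)) (UNIV \<rightarrow>\<^sub>E {..K})"
      by (intro sum_mono2 finite_PiE prod_nonneg) auto
    also have "\<dots> = (\<Prod>j\<in>UNIV. \<Sum>n\<le>K. \<bar>u j\<bar> ^ n / fact n)"
      by (rule prod_sum_PiE[symmetric]) auto
    also have "\<dots> \<le> (\<Prod>j\<in>UNIV. exp \<bar>u j\<bar>)"
    proof (intro prod_mono conjI)
      fix j
      show "(\<Sum>n\<le>K. \<bar>u j\<bar> ^ n / fact n) \<le> exp \<bar>u j\<bar>"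
        using has_sum_mono'[OF has_sum_finite exp_series[of "\<bar>u j\<bar>"], of "{..K}"] by simp
    qed (auto intro: sum_nonneg)
    finally show ?thesis .
  qed
  have "(\<lambda>\<alpha>. norm (?p u \<alpha>)) = ?p (\<lambda>j. \<bar>u j\<bar>)"
    by (simp add: abs_prod power_abs)
  moreover have "?p (\<lambda>j. \<bar>u j\<bar>) summable_on UNIV"
    using bound by (intro nonneg_bdd_above_summable_on prod_nonneg bdd_aboveI2) auto
  ultimately have "?p u summable_on UNIV"
    using abs_summable_summable[of "?p u" UNIV] by simp
  then have "(?p u has_sum infsum (?p u) UNIV) UNIV" by simp
  moreover have "infsum (?p u) UNIV = (\<Prod>j\<in>UNIV. infsum (\<lambda>n. u j ^ n / fact n) UNIV)"
    using infsum_prod_PiE_abs[of UNIV "\<lambda>j n. u j ^ n / fact n" "\<lambda>_. UNIV"] exp_abs by simp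
  moreover have "\<dots> = exp (\<Sum>j\<in>UNIV. u j)"
    by (simp only: infsumI[OF exp_series] exp_sum[OF finite])
  ultimately show ?thesis by simp
qed

section \<open>Projection onto kernel sections\<close>

context function_hilbert_space
begin

lemma ip_zero [simp]: "f \<in> H \<Longrightarrow> ip (fun_zero X) f = 0"
  using ip_scale[OF zero_closed, of f 0] by (simp add: fun_scale_def fun_zero_def restrict_def)

end

context rkhs
begin

definition kernel_sect :: "'a \<Rightarrow> 'a \<Rightarrow> real" where "kernel_sect x = (\<lambda>y\<in>X. k y x)"

definition kernel_comb :: "'a set \<Rightarrow> ('a \<Rightarrow> real) \<Rightarrow> 'a \<Rightarrow> real" where
  "kernel_comb F a = (\<lambda>x\<in>X. \<Sum>y\<in>F. a y * k x y)"

lemma kernel_comb_insert: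
  assumes "finite F" "z \<notin> F"
  shows "kernel_comb (insert z F) a = fun_add X (fun_scale X (a z) (kernel_sect z)) (kernel_comb F a)"
  using assms by (auto simp: kernel_comb_def kernel_sect_def fun_add_def fun_scale_def)

lemma kernel_comb_closed_ip:
  assumes "finite F" "F \<subseteq> X"
  shows "kernel_comb F a \<in> H \<and> (\<forall>h\<in>H. ip (kernel_comb F a) h = (\<Sum>y\<in>F. a y * h y))"
  using assms
proof (induction F rule: finite_induct)
  case empty
  have "kernel_comb {} a = fun_zero X" by (simp add: kernel_comb_def fun_zero_def)
  then show ?case by (simp add: zero_closed)
next
  case (insert z F)
  have z: "kernel_sect z \<in> H" "fun_scale X (a z) (kernel_sect z) \<in> H"
    using insert.prems kernel_section scale_closed by (auto simp: kernel_sect_def)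
  have "ip (kernel_sect z) h = h z" if "h \<in> H" for h
    using reproducing[OF that, of z] ip_sym[OF z(1) that] insert.prems by (simp add: kernel_sect_def)
  then show ?case
    using insert z by (simp add: kernel_comb_insert add_closed ip_add ip_scale)
qed

lemmas kernel_comb_closed = kernel_comb_closed_ip[THEN conjunct1]
lemmas ip_kernel_comb = kernel_comb_closed_ip[THEN conjunct2, rule_format]

definition residual :: "('a \<Rightarrow> real) \<Rightarrow> 'a set \<Rightarrow> ('a \<Rightarrow> real) \<Rightarrow> 'a \<Rightarrow> real" where
  "residual f F a = fun_add X f (fun_scale X (-1) (kernel_comb F a))"

lemma residual_closed: "f \<in> H \<Longrightarrow> finite F \<Longrightarrow> F \<subseteq> X \<Longrightarrow> residual f F a \<in> H"
  by (simp add: residual_def add_closed scale_closed kernel_comb_closed)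

lemma residual_apply: "x \<in> X \<Longrightarrow> residual f F a x = f x - kernel_comb F a x"
  by (simp add: residual_def fun_add_def fun_scale_def)

lemma ip_residual:
  assumes "f \<in> H" "finite F" "F \<subseteq> X" "h \<in> H"
  shows "ip (residual f F a) h = ip f h - (\<Sum>y\<in>F. a y * h y)"
  using assms by (simp add: residual_def ip_add ip_scale scale_closed kernel_comb_closed ip_kernel_comb)

text \<open>
  By the reproducing property, a function in \<open>H\<close> is orthogonal to the sections at the points of \<open>F\<close>
  iff it vanishes on \<open>F\<close>. Interpolating \<open>f\<close> on \<open>F\<close> is therefore orthogonal projection onto a finite
  span of sections, and the induction is a Gram--Schmidt step: \<open>t\<close> is the part of the new section
  that is orthogonal to the old ones. If the new section depends on the old ones, then \<open>t\<close> is zero and the old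
  interpolant is already correct at the new point.
\<close>

lemma kernel_comb_interpolates:
  assumes "finite F" "F \<subseteq> X" "f \<in> H"
  shows "\<exists>a. \<forall>x\<in>F. f x = kernel_comb F a x"
  using assms
proof (induction F arbitrary: f rule: finite_induct)
  case empty
  then show ?case by simp
next
  case (insert z F)
  then have zX: "z \<in> X" and F: "finite F" "F \<subseteq> X" by auto
  have sz: "kernel_sect z \<in> H" using zX kernel_section by (simp add: kernel_sect_def)
  obtain a where a: "\<forall>x\<in>F. f x = kernel_comb F a x"
    using insert.IH F insert.prems by blast
  obtain b where b: "\<forall>x\<in>F. kernel_sect z x = kernel_comb F b x"
    using insert.IH F sz by blast
  define r where "r = residual f F a"
  define t where "t = residual (kernel_sect z) F b"
  have rH: "r \<in> H" and tH: "t \<in> H"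
    using F sz insert.prems by (simp_all add: r_def t_def residual_closed)
  have r0: "r x = 0" and t0: "t x = 0" if "x \<in> F" for x
    using that a b F by (auto simp: r_def t_def residual_apply subset_iff)
  have tr: "ip t h = h z" if "h \<in> H" "\<forall>x\<in>F. h x = 0" for h
  proof -
    have "ip t h = ip (kernel_sect z) h - (\<Sum>y\<in>F. b y * h y)"
      unfolding t_def by (rule ip_residual[OF sz F that(1)])
    also have "ip (kernel_sect z) h = h z"
      using reproducing[OF that(1) zX] ip_sym[OF sz that(1)] by (simp add: kernel_sect_def)
    finally show ?thesis using that by simp
  qed
  define c where "c = r z / t z"
  have rz: "r z = c * t z"
  proof (cases "t z = 0")
    case True
    then have "ip t t = 0" using tr[OF tH] t0 by simp
    then have "t = fun_zero X" using ip_definite[OF tH] by simp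
    then have "r z = 0" using tr[OF rH] r0 ip_zero[OF rH] by simp
    then show ?thesis using True by simp
  qed (simp add: c_def)
  \<comment> \<open>The new interpolant is \<open>kernel_comb F a + c * t\<close>; these are its coefficients.\<close>
  define a' where "a' = (\<lambda>y. if y = z then c else a y - c * b y)"
  have "kernel_comb (insert z F) a' x = kernel_comb F a x + c * t x" if x: "x \<in> X" for x
  proof -
    have "(\<Sum>y\<in>F. a' y * k x y) = (\<Sum>y\<in>F. a y * k x y) - c * (\<Sum>y\<in>F. b y * k x y)"
      unfolding sum_distrib_left sum_subtractf[symmetric]
      using insert.hyps(2) by (intro sum.cong) (auto simp: a'_def algebra_simps)
    then show ?thesis
      using x insert.hyps by (simp add: kernel_comb_def t_def residual_apply kernel_sect_def a'_def algebra_simps)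
  qed
  moreover have "f x = kernel_comb F a x + c * t x" if "x \<in> insert z F" for x
  proof -
    have "r x = c * t x" using that rz r0 t0 by auto
    then show ?thesis using that zX F by (auto simp: r_def residual_apply subset_iff)
  qed
  ultimately show ?case using zX F by (intro exI[of _ a']) auto
qed

text \<open>
  The interpolant is the orthogonal projection of \<open>f\<close>, so its squared norm, a quadratic form in the
  kernel, is at most that of \<open>f\<close>. All later work on \<open>H\<close> goes through this estimate.
\<close>

lemma interpolation_energy_le:
  assumes "finite F" "F \<subseteq> X" "f \<in> H"
  obtains a where "\<And>x. x \<in> F \<Longrightarrow> f x = (\<Sum>y\<in>F. a y * k x y)"
    "(\<Sum>x\<in>F. \<Sum>y\<in>F. a x * a y * k x y) \<le> ip f f"
proof -
  obtain a where a: "\<forall>x\<in>F. f x = kernel_comb F a x"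
    using kernel_comb_interpolates[OF assms] by blast
  have v: "f x = (\<Sum>y\<in>F. a y * k x y)" if "x \<in> F" for x
    using a that assms(2) by (auto simp: kernel_comb_def)
  let ?r = "residual f F a"
  have r: "?r \<in> H" "\<forall>x\<in>F. ?r x = 0"
    using assms a by (auto simp: residual_closed residual_apply subset_iff)
  have "0 \<le> ip ?r ?r" using r by (simp add: ip_nonneg)
  also have "\<dots> = ip f ?r" using assms r by (simp add: ip_residual)
  also have "\<dots> = ip ?r f" using assms r by (intro ip_sym)
  also have "\<dots> = ip f f - (\<Sum>x\<in>F. a x * f x)" using assms by (simp add: ip_residual)
  also have "(\<Sum>x\<in>F. a x * f x) = (\<Sum>x\<in>F. \<Sum>y\<in>F. a x * a y * k x y)"
    using v by (simp add: sum_distrib_left mult.assoc)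
  finally show ?thesis using that v by simp
qed

end

section \<open>Feature expansion of the Gaussian kernel\<close>

text \<open>
  The Taylor features of the Gaussian kernel. They come from
  $e^{-\sigma^2 |x - y|^2} = e^{-\sigma^2 |x|^2} e^{-\sigma^2 |y|^2} e^{2 \sigma^2 \langle x, y\rangle}$
  and the power series of the last factor, whose coefficients are split evenly between \<open>x\<close> and \<open>y\<close>.
\<close>

definition gauss_feature :: "real \<Rightarrow> ('d::finite \<Rightarrow> nat) \<Rightarrow> real ^ 'd \<Rightarrow> real" where
  "gauss_feature \<sigma> \<alpha> x = exp (- (\<sigma>\<^sup>2 * (norm x)\<^sup>2)) *
    (\<Prod>j\<in>UNIV. sqrt ((2 * \<sigma>\<^sup>2) ^ \<alpha> j / fact (\<alpha> j)) * (x $ j) ^ \<alpha> j)"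

lemma gauss_feature_mult:
  "gauss_feature \<sigma> \<alpha> x * gauss_feature \<sigma> \<alpha> y = exp (- (\<sigma>\<^sup>2 * ((norm x)\<^sup>2 + (norm y)\<^sup>2))) *
    (\<Prod>j\<in>UNIV. (2 * \<sigma>\<^sup>2 * (x $ j * y $ j)) ^ \<alpha> j / fact (\<alpha> j))"
proof -
  have sq: "sqrt c * u * (sqrt c * v) = c * (u * v)" if "c \<ge> 0" for c u v :: real
    using real_sqrt_mult_self[of c] that by (metis abs_of_nonneg mult.assoc mult.left_commute)
  have prods: "(\<Prod>j\<in>UNIV. sqrt ((2 * \<sigma>\<^sup>2) ^ \<alpha> j / fact (\<alpha> j)) * (x $ j) ^ \<alpha> j) *
      (\<Prod>j\<in>UNIV. sqrt ((2 * \<sigma>\<^sup>2) ^ \<alpha> j / fact (\<alpha> j)) * (y $ j) ^ \<alpha> j)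
    = (\<Prod>j\<in>UNIV. (2 * \<sigma>\<^sup>2 * (x $ j * y $ j)) ^ \<alpha> j / fact (\<alpha> j))"
    unfolding prod.distrib[symmetric]
    by (intro prod.cong refl, subst sq) (simp_all add: power_mult_distrib)
  have exps: "exp (- (\<sigma>\<^sup>2 * ((norm x)\<^sup>2 + (norm y)\<^sup>2)))
      = exp (- (\<sigma>\<^sup>2 * (norm x)\<^sup>2)) * exp (- (\<sigma>\<^sup>2 * (norm y)\<^sup>2))"
    by (simp add: exp_add[symmetric] algebra_simps)
  have regroup: "a * p * (b * q) = a * b * (p * q)" for a b p q :: real
    by simp
  show ?thesis
    unfolding gauss_feature_def prods[symmetric] exps by (rule regroup)
qed

lemma gaussian_kernel_has_sum:
  "((\<lambda>\<alpha>. gauss_feature \<sigma> \<alpha> x * gauss_feature \<sigma> \<alpha> y) has_sum gaussian_kernel \<sigma> x y) UNIV"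
proof -
  have norm_sq_diff: "(norm (x - y))\<^sup>2 = (norm x)\<^sup>2 + (norm y)\<^sup>2 - 2 * (x \<bullet> y)"
    using dot_norm_neg[of x y] by simp
  have "gaussian_kernel \<sigma> x y = exp (- (\<sigma>\<^sup>2 * ((norm x)\<^sup>2 + (norm y)\<^sup>2))) *
      exp (\<Sum>j\<in>UNIV. 2 * \<sigma>\<^sup>2 * (x $ j * y $ j))"
    unfolding gaussian_kernel_def exp_add[symmetric] sum_distrib_left[symmetric]
    by (simp add: norm_sq_diff inner_vec_def algebra_simps)
  then show ?thesis
    unfolding gauss_feature_mult
    by (simp only: has_sum_cmult_right exp_has_sum_multiindex)
qed

text \<open>
  For $|x| = 1$ the sum over the degrees above \<open>n\<close> is the probability that a Poisson variable with
  mean \<open>2 * \<sigma>\<^sup>2\<close> exceeds \<open>n\<close>, and the bound is Chernoff's: weight a term of degree \<open>m\<close> by \<open>\<theta> ^ m\<close> and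
  sum over all multi-indices.
\<close>

lemma gauss_feature_tail:
  fixes x :: "real ^ 'd"
  assumes "norm x \<le> 1" "\<theta> \<ge> 1"
  obtains t where "((\<lambda>\<alpha>. (gauss_feature \<sigma> \<alpha> x)\<^sup>2) has_sum t) {\<alpha>. multi_deg \<alpha> > n}"
    "t \<le> exp (2 * \<sigma>\<^sup>2 * (\<theta> - 1)) / \<theta> ^ Suc n"
proof -
  let ?T = "{\<alpha> :: 'd \<Rightarrow> nat. multi_deg \<alpha> > n}"
  let ?g = "\<lambda>\<alpha>. (gauss_feature \<sigma> \<alpha> x)\<^sup>2"
  let ?E = "exp (- (2 * \<sigma>\<^sup>2 * (norm x)\<^sup>2))"
  let ?h = "\<lambda>\<alpha>. ?E * (\<Prod>j\<in>UNIV. (\<theta> * (2 * \<sigma>\<^sup>2 * (x $ j)\<^sup>2)) ^ \<alpha> j / fact (\<alpha> j))"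
  have "(\<lambda>\<alpha>. gauss_feature \<sigma> \<alpha> x * gauss_feature \<sigma> \<alpha> x) summable_on ?T"
    using gaussian_kernel_has_sum summable_on_subset_banach[OF _ subset_UNIV]
    by (metis has_sum_imp_summable)
  then obtain t where t: "(?g has_sum t) ?T"
    by (auto simp: summable_on_def power2_eq_square)
  have h: "(?h has_sum (?E * exp (\<Sum>j\<in>UNIV. \<theta> * (2 * \<sigma>\<^sup>2 * (x $ j)\<^sup>2)))) UNIV"
    by (intro has_sum_cmult_right exp_has_sum_multiindex)
  have gh: "\<theta> ^ multi_deg \<alpha> * ?g \<alpha> = ?h \<alpha>" for \<alpha>
    by (simp add: power2_eq_square[of "gauss_feature \<sigma> \<alpha> x"] gauss_feature_mult multi_deg_def
        power_sum power_mult_distrib prod.distrib prod_dividef power2_eq_square mult_ac)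
  have "\<theta> ^ Suc n * t \<le> ?E * exp (\<Sum>j\<in>UNIV. \<theta> * (2 * \<sigma>\<^sup>2 * (x $ j)\<^sup>2))"
  proof (rule has_sum_mono_neutral[OF has_sum_cmult_right[OF t] h])
    fix \<alpha> :: "'d \<Rightarrow> nat"
    assume "\<alpha> \<in> ?T \<inter> UNIV"
    then have "\<theta> ^ Suc n * ?g \<alpha> \<le> \<theta> ^ multi_deg \<alpha> * ?g \<alpha>"
      using assms by (intro mult_right_mono power_increasing) auto
    then show "\<theta> ^ Suc n * ?g \<alpha> \<le> ?h \<alpha>" by (simp only: gh)
  next
    fix \<alpha> :: "'d \<Rightarrow> nat"
    have "0 \<le> \<theta> ^ multi_deg \<alpha> * ?g \<alpha>" using assms by simp
    then show "0 \<le> ?h \<alpha>" by (simp only: gh)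
  qed auto
  also have "(\<Sum>j\<in>UNIV. \<theta> * (2 * \<sigma>\<^sup>2 * (x $ j)\<^sup>2)) = \<theta> * (2 * \<sigma>\<^sup>2 * (norm x)\<^sup>2)"
    by (simp add: sum_distrib_left[symmetric] power2_norm_eq_inner inner_vec_def
        flip: power2_eq_square)
  also have "?E * exp (\<theta> * (2 * \<sigma>\<^sup>2 * (norm x)\<^sup>2)) = exp ((2 * \<sigma>\<^sup>2 * (\<theta> - 1)) * (norm x)\<^sup>2)"
    by (simp add: exp_add[symmetric] algebra_simps)
  also have "\<dots> \<le> exp ((2 * \<sigma>\<^sup>2 * (\<theta> - 1)) * 1)"
    using assms by (subst exp_le_cancel_iff, intro mult_left_mono) (auto simp: power_le_one)
  finally have "t \<le> exp (2 * \<sigma>\<^sup>2 * (\<theta> - 1)) / \<theta> ^ Suc n"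
    using assms by (simp add: le_divide_eq mult.commute)
  with t that show ?thesis by blast
qed

text \<open>
  The Cauchy--Schwarz inequality for series in the form needed here, obtained termwise from
  $2 |w| |p| \le \tau w^2 + p^2 / \tau$.
\<close>

lemma has_sum_mult_le:
  fixes w p :: "'i \<Rightarrow> real"
  assumes "((\<lambda>i. (w i)\<^sup>2) has_sum a) I" "a \<le> 1" "((\<lambda>i. (p i)\<^sup>2) has_sum b) I" "b \<le> \<tau>\<^sup>2"
    "((\<lambda>i. w i * p i) has_sum s) I" "\<tau> > 0"
  shows "\<bar>s\<bar> \<le> \<tau>"
proof -
  have "norm s \<le> \<tau> / 2 * a + 1 / (2 * \<tau>) * b"
  proof (rule norm_infsum_le)
    show "((\<lambda>i. \<tau> / 2 * (w i)\<^sup>2 + 1 / (2 * \<tau>) * (p i)\<^sup>2) has_sum (\<tau> / 2 * a + 1 / (2 * \<tau>) * b)) I"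
      using assms by (intro has_sum_add has_sum_cmult_right)
    fix i
    have "0 \<le> (\<tau> * \<bar>w i\<bar> - \<bar>p i\<bar>)\<^sup>2" by simp
    then have "2 * \<tau> * (\<bar>w i\<bar> * \<bar>p i\<bar>) \<le> \<tau>\<^sup>2 * (w i)\<^sup>2 + (p i)\<^sup>2"
      by (simp add: power2_diff power_mult_distrib mult_ac)
    then show "norm (w i * p i) \<le> \<tau> / 2 * (w i)\<^sup>2 + 1 / (2 * \<tau>) * (p i)\<^sup>2"
      using \<open>\<tau> > 0\<close> by (simp add: abs_mult field_simps power2_eq_square)
  qed (use assms in auto)
  also have "\<dots> \<le> \<tau> / 2 * 1 + 1 / (2 * \<tau>) * \<tau>\<^sup>2"
    using assms by (intro add_mono mult_left_mono) auto
  also have "\<dots> = \<tau>" using \<open>\<tau> > 0\<close> by (simp add: power2_eq_square)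
  finally show ?thesis by simp
qed

lemma has_sum_finite_sum:
  fixes g :: "'y \<Rightarrow> 'i \<Rightarrow> real"
  assumes "\<And>y. y \<in> F \<Longrightarrow> (g y has_sum s y) I"
  shows "((\<lambda>i. \<Sum>y\<in>F. g y i) has_sum (\<Sum>y\<in>F. s y)) I"
  using assms by (induction F rule: infinite_finite_induct) (auto intro: has_sum_add)

text \<open>
  On a finite set \<open>f\<close> agrees with a combination \<open>\<Sum>y\<in>F. a y * k x y\<close> of sections of norm at most one.
  In terms of the features it is a series with coefficients \<open>w \<alpha> = (\<Sum>y\<in>F. a y * gauss_feature \<sigma> \<alpha> y)\<close>,
  whose sum of squares is that squared norm. Restricting the series to \<open>A\<close> costs at most \<open>\<tau>\<close> by
  Cauchy--Schwarz.
\<close>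

lemma unit_ball_approx_on_finite:
  fixes X :: "(real ^ 'd) set"
  assumes H: "rkhs X (gaussian_kernel \<sigma>) H ip" and f: "f \<in> hilbert_unit_ball H ip"
    and F: "finite F" "F \<subseteq> X" and \<tau>: "\<tau> > 0"
    and tail: "\<And>x. x \<in> X \<Longrightarrow> \<exists>t \<le> \<tau>\<^sup>2. ((\<lambda>\<alpha>. (gauss_feature \<sigma> \<alpha> x)\<^sup>2) has_sum t) (- A)"
    and A: "finite A"
  obtains w where "L2_set w A \<le> 1"
    "\<And>x. x \<in> F \<Longrightarrow> \<bar>f x - (\<Sum>\<alpha>\<in>A. w \<alpha> * gauss_feature \<sigma> \<alpha> x)\<bar> \<le> \<tau>"
proof -
  interpret rkhs X "gaussian_kernel \<sigma>" H ip by fact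
  have fH: "f \<in> H" and f1: "ip f f \<le> 1"
    using f by (auto simp: hilbert_unit_ball_def ip_norm_def)
  obtain a where a: "\<And>x. x \<in> F \<Longrightarrow> f x = (\<Sum>y\<in>F. a y * gaussian_kernel \<sigma> x y)"
    and energy: "(\<Sum>x\<in>F. \<Sum>y\<in>F. a x * a y * gaussian_kernel \<sigma> x y) \<le> ip f f"
    using interpolation_energy_le[OF F fH] by blast
  define w where "w \<alpha> = (\<Sum>y\<in>F. a y * gauss_feature \<sigma> \<alpha> y)" for \<alpha>
  have w2: "((\<lambda>\<alpha>. (w \<alpha>)\<^sup>2) has_sum (\<Sum>x\<in>F. \<Sum>y\<in>F. a x * a y * gaussian_kernel \<sigma> x y)) UNIV"
  proof -
    have "(w \<alpha>)\<^sup>2 = (\<Sum>x\<in>F. \<Sum>y\<in>F. a x * a y * (gauss_feature \<sigma> \<alpha> x * gauss_feature \<sigma> \<alpha> y))" for \<alpha>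
      by (simp add: w_def power2_eq_square sum_product mult_ac)
    then show ?thesis
      by (simp only:) (intro has_sum_finite_sum has_sum_cmult_right gaussian_kernel_has_sum)
  qed
  have wf: "((\<lambda>\<alpha>. w \<alpha> * gauss_feature \<sigma> \<alpha> x) has_sum f x) UNIV" if "x \<in> F" for x
  proof -
    have "w \<alpha> * gauss_feature \<sigma> \<alpha> x
        = (\<Sum>y\<in>F. a y * (gauss_feature \<sigma> \<alpha> x * gauss_feature \<sigma> \<alpha> y))" for \<alpha>
      by (simp add: w_def sum_distrib_left sum_distrib_right mult_ac)
    then show ?thesis
      by (simp only: a[OF that]) (intro has_sum_finite_sum has_sum_cmult_right gaussian_kernel_has_sum)
  qed
  have split: "(g has_sum (s - sum g A)) (- A)" if "(g has_sum s) UNIV" for g :: "('d \<Rightarrow> nat) \<Rightarrow> real" and s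
    using has_sum_Diff[OF that has_sum_finite[OF A]] by (simp add: Compl_eq_Diff_UNIV)
  have le1: "(\<Sum>x\<in>F. \<Sum>y\<in>F. a x * a y * gaussian_kernel \<sigma> x y) \<le> 1"
    using energy f1 by simp
  show ?thesis
  proof (rule that[of w])
    have "(\<Sum>\<alpha>\<in>A. (w \<alpha>)\<^sup>2) \<le> (\<Sum>x\<in>F. \<Sum>y\<in>F. a x * a y * gaussian_kernel \<sigma> x y)"
      using has_sum_mono'[OF has_sum_finite[OF A] w2] by simp
    then show "L2_set w A \<le> 1" using le1 by (simp add: L2_set_def)
  next
    fix x assume x: "x \<in> F"
    obtain t where t: "t \<le> \<tau>\<^sup>2" "((\<lambda>\<alpha>. (gauss_feature \<sigma> \<alpha> x)\<^sup>2) has_sum t) (- A)"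
      using tail x F by blast
    show "\<bar>f x - (\<Sum>\<alpha>\<in>A. w \<alpha> * gauss_feature \<sigma> \<alpha> x)\<bar> \<le> \<tau>"
      using sum_nonneg[of A "\<lambda>\<alpha>. (w \<alpha>)\<^sup>2"] le1
      by (intro has_sum_mult_le[OF split[OF w2] _ t(2,1) split[OF wf[OF x]] \<tau>]) auto
  qed
qed

section \<open>Covering numbers\<close>

lemma log_covering_number_le:
  fixes C :: "'b set"
  assumes "finite C" "C \<noteq> {}" "C \<subseteq> mspace m" "T ` B \<subseteq> (\<Union>c\<in>C. mcball_of m c \<epsilon>)"
  shows "log_covering_number T B m \<epsilon> \<le> ereal (ln (real (card C)))"
proof -
  obtain x where x: "bij_betw x {1..card C} C"
    using ex_bij_betw_nat_finite_1[OF assms(1)] by blast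
  have pos: "card C \<ge> 1"
    using assms(1,2) by (simp add: Suc_leI card_gt_0_iff)
  have img: "x ` {1..card C} = C" using x by (rule bij_betw_imp_surj_on)
  have "\<forall>i\<in>{1..card C}. x i \<in> mspace m"
    using assms(3) img by blast
  moreover have "(\<Union>i\<in>{1..card C}. mcball_of m (x i) \<epsilon>) = (\<Union>c\<in>x ` {1..card C}. mcball_of m c \<epsilon>)"
    by simp
  then have "T ` B \<subseteq> (\<Union>i\<in>{1..card C}. mcball_of m (x i) \<epsilon>)"
    using assms(4) by (simp only: img)
  ultimately have "covering_number m (T ` B) \<epsilon> \<le> enat (card C)"
    unfolding covering_number_def using pos
    by (intro Inf_lower CollectI exI[of _ "card C"] exI[of _ x] conjI refl)
  then obtain n where n: "covering_number m (T ` B) \<epsilon> = enat n" "n \<le> card C"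
    by (cases "covering_number m (T ` B) \<epsilon>") auto
  have "ln (real n) \<le> ln (real (card C))"
    using n(2) pos by (cases "n = 0") auto
  then show ?thesis using n(1) by (simp add: log_covering_number_def)
qed

text \<open>
  Replace a function in the unit ball by its \<open>A\<close>-part, with error \<open>\<tau>\<close>, and the coefficients of that
  part by an element of a \<open>\<delta>\<close>-net of the Euclidean unit ball. The feature vectors have norm at most
  one, so perturbing the coefficients by \<open>\<delta>\<close> changes the function by at most \<open>\<delta>\<close> uniformly.
\<close>

lemma log_covering_number_gaussian_le:
  fixes X :: "(real ^ 'd) set" and A :: "('d \<Rightarrow> nat) set"
  assumes H: "rkhs X (gaussian_kernel \<sigma>) H ip" and X: "X \<noteq> {}"
    and A: "finite A" and \<tau>: "\<tau> > 0" and \<delta>: "\<delta> > 0"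
    and tail: "\<And>x. x \<in> X \<Longrightarrow> \<exists>t \<le> \<tau>\<^sup>2. ((\<lambda>\<alpha>. (gauss_feature \<sigma> \<alpha> x)\<^sup>2) has_sum t) (- A)"
  shows "log_covering_number (\<lambda>f. f) (hilbert_unit_ball H ip) (linfty X) (\<delta> + \<tau>)
    \<le> ereal (real (card A) * ln (1 + 2 / \<delta>))"
proof -
  interpret rkhs X "gaussian_kernel \<sigma>" H ip by fact
  define G where "G w = (\<lambda>x\<in>X. \<Sum>\<alpha>\<in>A. w \<alpha> * gauss_feature \<sigma> \<alpha> x)" for w
  have feat: "L2_set (\<lambda>\<alpha>. gauss_feature \<sigma> \<alpha> x) A \<le> 1" for x :: "real ^ 'd"
  proof -
    have "(\<Sum>\<alpha>\<in>A. (gauss_feature \<sigma> \<alpha> x)\<^sup>2) \<le> gaussian_kernel \<sigma> x x"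
      using has_sum_mono'[OF has_sum_finite[OF A] gaussian_kernel_has_sum[of \<sigma> x x]]
      by (simp add: power2_eq_square)
    then show ?thesis by (simp add: L2_set_def gaussian_kernel_def)
  qed
  have pair: "\<bar>\<Sum>\<alpha>\<in>A. w \<alpha> * gauss_feature \<sigma> \<alpha> x\<bar> \<le> L2_set w A" for w and x :: "real ^ 'd"
  proof -
    have "\<bar>\<Sum>\<alpha>\<in>A. w \<alpha> * gauss_feature \<sigma> \<alpha> x\<bar> \<le> (\<Sum>\<alpha>\<in>A. \<bar>w \<alpha>\<bar> * \<bar>gauss_feature \<sigma> \<alpha> x\<bar>)"
      by (simp add: abs_mult[symmetric] sum_abs)
    also have "\<dots> \<le> L2_set w A * L2_set (\<lambda>\<alpha>. gauss_feature \<sigma> \<alpha> x) A"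
      by (rule L2_set_mult_ineq)
    also have "\<dots> \<le> L2_set w A * 1"
      using feat by (intro mult_left_mono) auto
    finally show ?thesis by simp
  qed
  have Gmem: "G w \<in> mspace (linfty X)" for w
    using pair by (auto simp: mspace_linfty G_def bounded_iff)
  have Hmem: "f \<in> mspace (linfty X)" if f: "f \<in> hilbert_unit_ball H ip" for f
  proof -
    have "\<bar>f x\<bar> \<le> 1 + \<tau>" if x: "x \<in> X" for x
    proof -
      obtain w where "L2_set w A \<le> 1" "\<bar>f x - (\<Sum>\<alpha>\<in>A. w \<alpha> * gauss_feature \<sigma> \<alpha> x)\<bar> \<le> \<tau>"
        using unit_ball_approx_on_finite[OF H f, of "{x}", OF _ _ \<tau> tail A] x by blast
      then show ?thesis using pair[where w=w and x=x] by linarith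
    qed
    then show ?thesis
      using f carrier by (auto simp: mspace_linfty bounded_iff hilbert_unit_ball_def)
  qed
  obtain C :: "(('d \<Rightarrow> nat) \<Rightarrow> real) set" where C: "finite C"
      "real (card C) \<le> (1 + 2 / \<delta>) ^ card A"
    and net: "\<And>w. L2_set w A \<le> 1 \<Longrightarrow> \<exists>c\<in>C. L2_set (\<lambda>i. w i - c i) A \<le> \<delta>"
    using L2_ball_net[OF A \<delta>] by blast
  have "C \<noteq> {}" using net[of "\<lambda>_. 0"] by (auto simp: L2_set_def)
  \<comment> \<open>The approximation is available on finite sets only. This suffices: if no element of the
    finite net were uniformly close to \<open>f\<close>, one point of failure for each of them would form a
    finite set on which the approximation of \<open>f\<close> is impossible.\<close>
  have near: "\<exists>c\<in>C. \<forall>x\<in>X. \<bar>f x - G c x\<bar> \<le> \<delta> + \<tau>" if f: "f \<in> hilbert_unit_ball H ip" for f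
  proof (rule ccontr)
    assume "\<not> ?thesis"
    then have "\<forall>c\<in>C. \<exists>x\<in>X. \<not> \<bar>f x - G c x\<bar> \<le> \<delta> + \<tau>" by blast
    then obtain bad where bad: "\<And>c. c \<in> C \<Longrightarrow> bad c \<in> X"
        "\<And>c. c \<in> C \<Longrightarrow> \<not> \<bar>f (bad c) - G c (bad c)\<bar> \<le> \<delta> + \<tau>"
      by metis
    obtain w where w: "L2_set w A \<le> 1"
        "\<And>x. x \<in> bad ` C \<Longrightarrow> \<bar>f x - (\<Sum>\<alpha>\<in>A. w \<alpha> * gauss_feature \<sigma> \<alpha> x)\<bar> \<le> \<tau>"
      using unit_ball_approx_on_finite[OF H f, of "bad ` C", OF _ _ \<tau> tail A] bad(1) C(1) by blast
    obtain c where c: "c \<in> C" "L2_set (\<lambda>i. w i - c i) A \<le> \<delta>"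
      using net[OF w(1)] by blast
    define x where "x = bad c"
    have x: "x \<in> X" "x \<in> bad ` C" using bad(1) c(1) by (auto simp: x_def)
    have "\<bar>(\<Sum>\<alpha>\<in>A. w \<alpha> * gauss_feature \<sigma> \<alpha> x) - G c x\<bar> \<le> \<delta>"
      using pair[of "\<lambda>i. w i - c i" x] c(2) x(1)
      by (simp add: G_def left_diff_distrib sum_subtractf)
    then have "\<bar>f x - G c x\<bar> \<le> \<delta> + \<tau>" using w(2)[OF x(2)] by linarith
    then show False using bad(2)[OF c(1)] by (simp add: x_def)
  qed
  have cover: "(\<lambda>f. f) ` hilbert_unit_ball H ip \<subseteq> (\<Union>g\<in>G ` C. mcball_of (linfty X) g (\<delta> + \<tau>))"
  proof (intro subsetI)
    fix f assume "f \<in> (\<lambda>f. f) ` hilbert_unit_ball H ip"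
    then have f: "f \<in> hilbert_unit_ball H ip" by simp
    obtain c where c: "c \<in> C" "\<And>x. x \<in> X \<Longrightarrow> \<bar>f x - G c x\<bar> \<le> \<delta> + \<tau>"
      using near[OF f] by blast
    have "mdist (linfty X) (G c) f \<le> \<delta> + \<tau>"
      using c(2) X by (simp add: mdist_linfty[OF Gmem Hmem[OF f]] abs_minus_commute cSUP_least)
    then show "f \<in> (\<Union>g\<in>G ` C. mcball_of (linfty X) g (\<delta> + \<tau>))"
      using c(1) Gmem Hmem[OF f] by auto
  qed
  have "log_covering_number (\<lambda>f. f) (hilbert_unit_ball H ip) (linfty X) (\<delta> + \<tau>)
      \<le> ereal (ln (real (card (G ` C))))"
    using C(1) \<open>C \<noteq> {}\<close> Gmem by (intro log_covering_number_le cover) auto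
  also have "ln (real (card (G ` C))) \<le> ln ((1 + 2 / \<delta>) ^ card A)"
    using C \<open>C \<noteq> {}\<close> card_image_le[OF C(1), of G]
    by (intro ln_mono) (auto simp: card_gt_0_iff)
  also have "\<dots> = real (card A) * ln (1 + 2 / \<delta>)"
    by (rule ln_realpow)
  finally show ?thesis by simp
qed

text \<open>
  Both sides are products of \<open>d\<close> factors over \<open>fact d\<close>, and \<open>n + i \<le> t * x + i \<le> (t + i) * x\<close>.
\<close>

lemma binomial_le_gchoose:
  fixes t x :: real
  assumes "real n \<le> t * x" "x \<ge> 1" "t \<ge> 0"
  shows "real ((n + d) choose d) \<le> ((t + real d) gchoose d) * x ^ d"
proof -
  have "real ((n + d) choose d) = (real n + real d) gchoose d"
    by (simp add: binomial_gbinomial)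
  also have "\<dots> = (\<Prod>i=1..d. real n + real i) / fact d"
    by (rule gchoose_shift_eq)
  also have "\<dots> \<le> (\<Prod>i=1..d. (t + real i) * x) / fact d"
  proof (intro divide_right_mono prod_mono conjI)
    fix i
    have "real i * 1 \<le> real i * x" using assms by (intro mult_left_mono) auto
    then show "real n + real i \<le> (t + real i) * x" using assms by (simp add: distrib_right)
  qed auto
  also have "\<dots> = ((t + real d) gchoose d) * x ^ d"
    by (simp add: gchoose_shift_eq prod.distrib)
  finally show ?thesis .
qed

theorem theorem2p1:
  fixes \<sigma> \<epsilon> :: real
    and H :: "(real ^ 'd \<Rightarrow> real) set"
    and ip :: "(real ^ 'd \<Rightarrow> real) \<Rightarrow> (real ^ 'd \<Rightarrow> real) \<Rightarrow> real"
  defines "d \<equiv> CARD('d)"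
  assumes "\<sigma> > 0" and "0 < \<epsilon>" and "\<epsilon> \<le> 1"
    and "rkhs (cball 0 1) (gaussian_kernel \<sigma>) H ip"
  shows "log_covering_number (\<lambda>f. f) (hilbert_unit_ball H ip) (linfty (cball 0 1)) \<epsilon>
    \<le> ereal (((2 * exp 1 * (1 + \<sigma>\<^sup>2) + real d) gchoose d) * exp (- real d)
        * (ln (4 / \<epsilon>) ^ (d + 1) / ln (ln (4 / \<epsilon>)) ^ d))"
proof -
  define L where "L = ln (4 / \<epsilon>)"
  \<comment> \<open>The degree of truncation. The Chernoff bound with parameter \<open>L\<close> is
    \<open>exp (2 * \<sigma>\<^sup>2 * (L - 1)) / L ^ Suc n\<close>, and \<open>Suc n \<ge> (2 * \<sigma>\<^sup>2 + 2) * L / ln L\<close> makes the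
    denominator at least \<open>exp ((2 * \<sigma>\<^sup>2 + 2) * L)\<close>, which leaves a factor \<open>exp (- 2 * L)\<close>.\<close>
  define n where "n = nat \<lfloor>(2 * \<sigma>\<^sup>2 + 2) * (L / ln L)\<rfloor>"
  define A where "A = {\<alpha> :: 'd \<Rightarrow> nat. multi_deg \<alpha> \<le> n}"
  have expL: "exp (- L) = \<epsilon> / 4"
    using assms by (simp add: L_def exp_minus)
  have "L \<ge> ln 4" using assms by (simp add: L_def le_divide_eq)
  moreover have "ln (exp 1) < ln (4::real)"
    using exp_le by (subst ln_less_cancel_iff) auto
  ultimately have L: "L > 1" by simp
  then have lnL: "ln L > 0" by simp
  have n: "real n \<le> (2 * \<sigma>\<^sup>2 + 2) * (L / ln L)" "(2 * \<sigma>\<^sup>2 + 2) * (L / ln L) \<le> real (Suc n)"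
  proof -
    have "0 \<le> (2 * \<sigma>\<^sup>2 + 2) * (L / ln L)" using L lnL by simp
    then have "real n = of_int \<lfloor>(2 * \<sigma>\<^sup>2 + 2) * (L / ln L)\<rfloor>"
      by (simp only: n_def of_nat_nat zero_le_floor)
    then show "real n \<le> (2 * \<sigma>\<^sup>2 + 2) * (L / ln L)" "(2 * \<sigma>\<^sup>2 + 2) * (L / ln L) \<le> real (Suc n)"
      by linarith+
  qed
  have "exp (2 * \<sigma>\<^sup>2 * (L - 1)) / L ^ Suc n \<le> (\<epsilon> / 4)\<^sup>2"
  proof -
    have "(2 * \<sigma>\<^sup>2 + 2) * L = (2 * \<sigma>\<^sup>2 + 2) * (L / ln L) * ln L" using lnL by simp
    also have "\<dots> \<le> real (Suc n) * ln L" using n(2) lnL by (intro mult_right_mono) auto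
    finally have "exp ((2 * \<sigma>\<^sup>2 + 2) * L) \<le> exp (real (Suc n) * ln L)" by simp
    also have "\<dots> = L ^ Suc n" using L by (simp only: exp_of_nat_mult exp_ln)
    finally have "exp (2 * \<sigma>\<^sup>2 * (L - 1)) / L ^ Suc n
        \<le> exp (2 * \<sigma>\<^sup>2 * (L - 1)) / exp ((2 * \<sigma>\<^sup>2 + 2) * L)"
      using L by (intro divide_left_mono) auto
    also have "\<dots> = exp (2 * (- L) - 2 * \<sigma>\<^sup>2)"
      by (simp add: exp_diff[symmetric] algebra_simps)
    also have "\<dots> \<le> exp (2 * (- L))" by simp
    also have "\<dots> = (\<epsilon> / 4)\<^sup>2" by (simp only: exp_double expL)
    finally show ?thesis .
  qed
  then have tail: "\<exists>t \<le> (\<epsilon> / 4)\<^sup>2. ((\<lambda>\<alpha>. (gauss_feature \<sigma> \<alpha> x)\<^sup>2) has_sum t) (- A)"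
    if "x \<in> cball 0 1" for x :: "real ^ 'd"
  proof -
    have "norm x \<le> 1" "L \<ge> 1" using that L by auto
    moreover have "- A = {\<alpha>. multi_deg \<alpha> > n}" by (auto simp: A_def)
    ultimately show ?thesis
      using gauss_feature_tail[of x L \<sigma> n] \<open>exp _ / _ \<le> _\<close> by (metis order_trans)
  qed
  \<comment> \<open>The truncation uses a quarter of \<open>\<epsilon>\<close>. The rest gives a net with at most
    \<open>(1 + 8 / (3 * \<epsilon>)) ^ card A\<close> elements, and \<open>1 + 8 / (3 * \<epsilon>) \<le> 4 / \<epsilon>\<close> because \<open>\<epsilon> \<le> 1\<close>.\<close>
  have "log_covering_number (\<lambda>f. f) (hilbert_unit_ball H ip) (linfty (cball 0 1)) (3 * \<epsilon> / 4 + \<epsilon> / 4)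
      \<le> ereal (real (card A) * ln (1 + 2 / (3 * \<epsilon> / 4)))"
    using assms tail by (intro log_covering_number_gaussian_le)
      (auto simp: A_def finite_multi_deg_le)
  also have "3 * \<epsilon> / 4 + \<epsilon> / 4 = \<epsilon>" by simp
  also have "real (card A) * ln (1 + 2 / (3 * \<epsilon> / 4)) \<le> real (card A) * L"
    unfolding L_def using assms
    by (intro mult_left_mono ln_mono) (auto simp: field_simps add_pos_pos)
  also have "\<dots> \<le> ((2 * exp 1 * (1 + \<sigma>\<^sup>2) + real d) gchoose d) * (L / (exp 1 * ln L)) ^ d * L"
  proof (intro mult_right_mono)
    \<comment> \<open>\<open>y - 1 \<ge> ln y\<close> at \<open>y = L / exp 1\<close>: this scale factor is at least one, as
      \<open>binomial_le_gchoose\<close> requires.\<close>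
    have "ln (L / exp 1) \<le> L / exp 1 - 1" using L by (intro ln_le_minus_one) simp
    then have "exp 1 * ln L \<le> L" using L by (simp add: ln_div field_simps)
    then have "1 \<le> L / (exp 1 * ln L)" using lnL by (simp add: le_divide_eq)
    moreover have "real n \<le> (2 * exp 1 * (1 + \<sigma>\<^sup>2)) * (L / (exp 1 * ln L))"
      using n(1) by (simp add: algebra_simps)
    ultimately have "real ((n + d) choose d)
        \<le> ((2 * exp 1 * (1 + \<sigma>\<^sup>2) + real d) gchoose d) * (L / (exp 1 * ln L)) ^ d"
      by (intro binomial_le_gchoose) auto
    moreover have "card A \<le> (n + d) choose d"
      using card_multi_deg_le[where ?'d = 'd] by (simp add: A_def d_def)
    ultimately show "real (card A)
        \<le> ((2 * exp 1 * (1 + \<sigma>\<^sup>2) + real d) gchoose d) * (L / (exp 1 * ln L)) ^ d"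
      by linarith
  qed (use L in simp)
  also have "\<dots> = ((2 * exp 1 * (1 + \<sigma>\<^sup>2) + real d) gchoose d) * exp (- real d)
        * (L ^ (d + 1) / ln L ^ d)"
    using exp_of_nat_mult[of d "1::real"]
    by (simp add: power_divide power_mult_distrib exp_minus field_simps)
  finally show ?thesis by (simp add: L_def)
qed

end
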